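(* Let $k \in \mathbb{N}$ with $k \geq 2$. For $\overline{\alpha} \in [1,\infty]$ let $$\delta_{\overline{\alpha}}(k) = \lim_{N\to\infty} \max_{S \subseteq T_{N,k}} \frac{|S|}{\binom{N}{k}},$$ where the maximum is taken over all zero-error codes $S \subseteq T_{N,k}$ with respect to $\overline{\alpha}$ (as defined in the context). Then the following hold (in particular, the limits exist). (1) For every $\overline{\alpha} \in [1,\infty)$, $$\delta_{\overline{\alpha}}(k) = \zeta(k)^{-1} \sum_{n=1}^{\infty} d_n^{-k},$$ where, if $\overline{\alpha} > 1$, the sequence $(d_n)_{n=1}^\infty$ is defined by $d_1 = 1$ and $d_n = \lceil \overline{\alpha}\, d_{n-1} \rceil$ for $n \geq 2$, and, if $\overline{\alpha} = 1$, $d_n = n$ for all $n \geq 1$. (2) For $\overline{\alpha} = \infty$, $$\delta_{\infty}(k) = \zeta(k)^{-1}.$$ Here $\zeta(k) = \sum_{n=1}^\infty n^{-k}$ is the Riemann zeta function.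
   Context: $\mathbb{N} = \{1,2,\ldots\}$ denotes the positive integers. For $N, k \in \mathbb{N}$, the set of signals is $$T_{N,k} = \Big\{ (t_1,\ldots,t_k) \in \mathbb{N}^k : \sum_{i=1}^k t_i \leq N \Big\},$$ which has cardinality $\binom{N}{k}$. A transmitted signal $\boldsymbol{t} \in T_{N,k}$ is received as $\alpha \boldsymbol{t} = (\alpha t_1, \ldots, \alpha t_k) \in \mathbb{R}^k$, where $\alpha$ is an unknown absolutely continuous random variable whose probability density function has support $A_{\overline{\alpha}}$, with $A_{\overline{\alpha}} = [1,\overline{\alpha}]$ if $\overline{\alpha} \in (1,\infty)$ and $A_{\infty} = [1,\infty)$. In the degenerate case $\overline{\alpha} = 1$, $\alpha$ is known and equal to $1$, i.e. $A_1 = \{1\}$. The definitions below depend on the distribution of $\alpha$ only through $A_{\overline{\alpha}}$. Two signals $\boldsymbol{t}', \boldsymbol{t}'' \in T_{N,k}$ are called confusable (with respect to $\overline{\alpha}$) if the sets of possible outputs $\{\alpha' \boldsymbol{t}' : \alpha' \in A_{\overline{\alpha}}\}$ and $\{\alpha'' \boldsymbol{t}'' : \alpha'' \in A_{\overline{\alpha}}\}$ have infinite intersection. A subset $S \subseteq T_{N,k}$ is called a zero-error code (with respect to $\overline{\alpha}$) if any two distinct elements of $S$ are non-confusable. For $\overline{\alpha} = 1$ all subsets of $T_{N,k}$ are zero-error codes. *)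

theory Defs
  imports "HOL-Analysis.Analysis"
begin

(* A signal (t_1, ..., t_k) is a list of length k; the points of R^k at which it can be
   received are represented in the same way. *)

definition signals :: "nat \<Rightarrow> nat \<Rightarrow> nat list set" where
  "signals N k = {t. length t = k \<and> (\<forall>x\<in>set t. 1 \<le> x) \<and> sum_list t \<le> N}"

(* For a bound abar >= 1 this is {1} if abar = 1, the interval [1, abar] if abar is finite,
   and [1, infinity) if abar is infinite. *)

definition stretch_factors :: "ereal \<Rightarrow> real set" where
  "stretch_factors abar = {a. 1 \<le> a \<and> ereal a \<le> abar}"

definition outputs :: "ereal \<Rightarrow> nat list \<Rightarrow> real list set" where
  "outputs abar t = {map (\<lambda>x. a * real x) t | a. a \<in> stretch_factors abar}"

definition confusable :: "ereal \<Rightarrow> nat list \<Rightarrow> nat list \<Rightarrow> bool" where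
  "confusable abar s t \<longleftrightarrow> infinite (outputs abar s \<inter> outputs abar t)"

definition zero_error_code :: "ereal \<Rightarrow> nat \<Rightarrow> nat \<Rightarrow> nat list set \<Rightarrow> bool" where
  "zero_error_code abar N k S \<longleftrightarrow>
     S \<subseteq> signals N k \<and> (\<forall>s\<in>S. \<forall>t\<in>S. s \<noteq> t \<longrightarrow> \<not> confusable abar s t)"

(* For N < k the denominator is 0 and the value is the irrelevant 0. *)

definition max_density :: "ereal \<Rightarrow> nat \<Rightarrow> nat \<Rightarrow> real" where
  "max_density abar k N =
     Max {real (card S) / real (N choose k) | S. zero_error_code abar N k S}"

definition delta :: "ereal \<Rightarrow> nat \<Rightarrow> real" where
  "delta abar k = lim (max_density abar k)"

definition zeta :: "nat \<Rightarrow> real" where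
  "zeta k = (\<Sum>n. 1 / real (Suc n) ^ k)"

(* Indices start at 0: d_seq a n is the term d_(n+1) of the sequence d_1, d_2, ...
   with d_1 = 1 and d_m = ceiling (a * d_(m-1)); for a = 1 that recursion would be constant
   and d_m = m is used instead. *)

primrec ceiling_seq :: "real \<Rightarrow> nat \<Rightarrow> int" where
  "ceiling_seq a 0 = 1"
| "ceiling_seq a (Suc n) = \<lceil>a * real_of_int (ceiling_seq a n)\<rceil>"

definition d_seq :: "real \<Rightarrow> nat \<Rightarrow> int" where
  "d_seq a n = (if a = 1 then int (Suc n) else ceiling_seq a n)"

end

theory Submission
  imports Defs
begin

text \<open>
  Every signal is a positive integer multiple of a unique primitive signal, its direction, and only
  signals with the same direction can be confusable: \<open>g p\<close> and \<open>h p\<close> with \<open>g < h\<close> are confusable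
  iff \<open>h < a g\<close>. On each ray the greedy choice of multipliers \<open>d\<^sub>1 < d\<^sub>2 < \<dots>\<close> is therefore optimal, so
  a largest code has \<open>\<Sum>n. P (N div d\<^sub>n)\<close> elements, where \<open>P M\<close> counts the primitive signals with sum
  at most \<open>M\<close>. For \<open>a = 1\<close> this reads \<open>N choose k = (\<Sum>n. P (N div n))\<close>, from which
  \<open>P N \<sim> (N choose k) / zeta k\<close> follows. Since \<open>N div d choose k\<close> is at most \<open>d\<^sup>-\<^sup>k (N choose k)\<close>,
  Tannery's theorem gives the limit of the sums.
\<close>

subsection \<open>Asymptotics of binomial sums\<close>

lemma summable_inverse_Suc_power:
  assumes "k \<ge> 2"
  shows "summable (\<lambda>n. 1 / real (Suc n) ^ k)"
proof -
  have "summable (\<lambda>n. inverse (real n ^ k))"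
    using inverse_power_summable[of k, where ?'a = real] assms by simp
  then have "summable (\<lambda>n. inverse (real (Suc n) ^ k))"
    by (subst summable_Suc_iff)
  then show ?thesis
    by (simp add: inverse_eq_divide)
qed

lemma zeta_minus_1:
  assumes "k \<ge> 2"
  shows "(\<lambda>n. 1 / real (Suc (Suc n)) ^ k) sums (zeta k - 1)"
proof -
  have "(\<lambda>n. 1 / real (Suc n) ^ k) sums zeta k"
    unfolding zeta_def using summable_inverse_Suc_power[OF assms] by (rule summable_sums)
  then show ?thesis
    by (subst sums_Suc_iff) simp
qed

lemma zeta_ge_1:
  assumes "k \<ge> 2"
  shows "zeta k \<ge> 1"
  using sums_le[OF _ sums_zero zeta_minus_1[OF assms]] by simp

text \<open>Comparison with the telescoping series of \<open>1 / ((n+1) * (n+2))\<close>, whose sum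
  is 1. The strict inequality is what later makes \<open>zeta k - 1\<close> a contraction
  factor.\<close>

lemma zeta_less_2:
  assumes "k \<ge> 2"
  shows "zeta k < 2"
proof -
  define b where "b n = 1 / real (Suc n) - 1 / real (Suc (Suc n))" for n
  have "b sums (1 / real (Suc 0) - 0)"
    unfolding b_def by (rule telescope_sums') (rule LIMSEQ_Suc[OF lim_1_over_n])
  then have b: "b sums 1"
    by simp
  have less: "1 / real (Suc (Suc n)) ^ k < b n" for n
  proof -
    have "real (Suc (Suc n)) ^ 2 \<le> real (Suc (Suc n)) ^ k"
      using assms by (intro power_increasing) auto
    then have "1 / real (Suc (Suc n)) ^ k \<le> 1 / real (Suc (Suc n)) ^ 2"
      by (intro divide_left_mono) auto
    also have "\<dots> < b n"
    proof -
      have "b n = 1 / (real (Suc n) * real (Suc (Suc n)))"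
        by (simp add: b_def field_simps)
      then show ?thesis
        by (simp only:, intro divide_strict_left_mono) (auto simp: power2_eq_square)
    qed
    finally show ?thesis .
  qed
  have diff: "(\<lambda>n. b n - 1 / real (Suc (Suc n)) ^ k) sums (1 - (zeta k - 1))"
    by (intro sums_diff b zeta_minus_1 assms)
  have "0 < (\<Sum>n. b n - 1 / real (Suc (Suc n)) ^ k)"
    using less by (intro suminf_pos sums_summable[OF diff]) (simp add: less_diff_eq)
  then show ?thesis
    using sums_unique[OF diff] by simp
qed

section \<open>Binomial coefficients at \<open>n div d\<close> and sums of them\<close>

lemma real_choose_eq_prod:
  "real (n choose k) = (\<Prod>i<k. real n - real i) / fact k"
  by (simp add: binomial_gbinomial gbinomial_prod_rev atLeast0LessThan)

text \<open>Factorwise: \<open>n div d - i \<le> (n - i) / d\<close> because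
  \<open>d \<ge> 1\<close>. This supplies a dominating bound that is uniform in
  \<open>n\<close>.\<close>

lemma choose_div_le:
  assumes "0 < d"
  shows "real (n div d choose k) \<le> real (n choose k) / real d ^ k"
proof (cases "k \<le> n div d")
  case True
  have "(\<Prod>i<k. real (n div d) - real i) \<le> (\<Prod>i<k. (real n - real i) / real d)"
  proof (rule prod_mono)
    fix i assume "i \<in> {..<k}"
    then have "i \<le> n div d"
      using True by simp
    moreover have "real (n div d) - real i \<le> real n / real d - real i / real d"
    proof (rule diff_mono)
      show "real (n div d) \<le> real n / real d"
        by (rule of_nat_div_le_of_nat)
      show "real i / real d \<le> real i"
        using assms by (simp add: field_simps mult_le_cancel_left1 flip: of_nat_mult)
    qed
    ultimately show "0 \<le> real (n div d) - real i \<and> real (n div d) - real i \<le> (real n - real i) / real d"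
      by (simp add: diff_divide_distrib)
  qed
  also have "\<dots> = (\<Prod>i<k. real n - real i) / real d ^ k"
    by (simp add: prod_dividef)
  finally show ?thesis
    by (simp add: real_choose_eq_prod field_simps)
next
  case False
  then show ?thesis
    by (simp add: binomial_eq_0)
qed

lemma tendsto_div_over:
  assumes "0 < d"
  shows "(\<lambda>n. real (n div d) / real n) \<longlonglongrightarrow> 1 / real d"
proof (rule tendsto_sandwich)
  show "\<forall>\<^sub>F n in sequentially. real (n div d) / real n \<le> 1 / real d"
  proof (intro eventually_sequentiallyI[of 1])
    fix n :: nat assume "1 \<le> n"
    then show "real (n div d) / real n \<le> 1 / real d"
      using of_nat_div_le_of_nat[of n d] by (simp add: field_simps)
  qed
  show "\<forall>\<^sub>F n in sequentially. 1 / real d - 1 / real n \<le> real (n div d) / real n"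
  proof (intro eventually_sequentiallyI[of 1])
    fix n :: nat assume "1 \<le> n"
    then have "1 / real d - 1 / real n = (real n / real d - 1) / real n"
      by (simp add: field_simps)
    also have "real n / real d - 1 \<le> real (n div d)"
      using floor_divide_of_nat_eq[of n d, where ?'a = real] by linarith
    finally show "1 / real d - 1 / real n \<le> real (n div d) / real n"
      by (simp add: divide_right_mono)
  qed
  show "(\<lambda>n. 1 / real d - 1 / real n) \<longlonglongrightarrow> 1 / real d"
    using tendsto_diff[OF tendsto_const lim_1_over_n, of "1 / real d"] by simp
qed simp

text \<open>The quotient is a product of \<open>k\<close> quotients of linear factors, each tending
  to \<open>1 / d\<close>; the factorials cancel.\<close>

lemma tendsto_choose_div:
  assumes "0 < d"
  shows "(\<lambda>n. real (n div d choose k) / real (n choose k)) \<longlonglongrightarrow> 1 / real d ^ k"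
proof -
  have "(\<lambda>n. (real (n div d) - real i) / (real n - real i)) \<longlonglongrightarrow> 1 / real d" for i
  proof -
    have "(\<lambda>n. (real (n div d) / real n - real i / real n) / (1 - real i / real n))
      \<longlonglongrightarrow> (1 / real d - 0) / (1 - 0)"
      by (intro tendsto_intros tendsto_div_over assms lim_const_over_n) simp
    moreover have "\<forall>\<^sub>F n in sequentially.
      (real (n div d) / real n - real i / real n) / (1 - real i / real n)
      = (real (n div d) - real i) / (real n - real i)"
      by (intro eventually_sequentiallyI[of "Suc i"]) (simp add: field_simps)
    ultimately show ?thesis
      by (simp add: tendsto_cong)
  qed
  then have "(\<lambda>n. \<Prod>i<k. (real (n div d) - real i) / (real n - real i)) \<longlonglongrightarrow> (\<Prod>i<k. 1 / real d)"
    by (intro tendsto_prod)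
  then show ?thesis
    by (simp add: real_choose_eq_prod prod_dividef power_one_over)
qed

text \<open>Tannery's theorem with dominating series \<open>1 / d i ^ k\<close>. The hypothesis
  \<open>n < d n\<close> makes that series summable and also kills all terms with
  \<open>i \<ge> n\<close>, so the finite sum is a full series.\<close>

lemma tendsto_sum_choose_div:
  fixes F :: "nat \<Rightarrow> real" and d :: "nat \<Rightarrow> nat"
  assumes k: "2 \<le> k"
    and bound: "\<And>n. \<bar>F n\<bar> \<le> real (n choose k)"
    and lim: "(\<lambda>n. F n / real (n choose k)) \<longlonglongrightarrow> x"
    and d: "\<And>n. n < d n"
  shows "(\<lambda>n. (\<Sum>i<n. F (n div d i)) / real (n choose k)) \<longlonglongrightarrow> x * (\<Sum>i. 1 / real (d i) ^ k)"
proof -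
  have d0: "0 < d i" for i
    using d[of i] by simp
  have inv: "1 / real (d i) ^ k \<le> 1 / real (Suc i) ^ k" for i
    using d[of i] d0[of i] by (intro divide_left_mono power_mono) (auto simp: Suc_le_eq)
  have summ: "summable (\<lambda>i. 1 / real (d i) ^ k)"
    using inv by (intro summable_comparison_test[OF _ summable_inverse_Suc_power[OF k]]) auto
  have F: "\<bar>F (n div d i)\<bar> \<le> real (n choose k) / real (d i) ^ k" for n i
    using bound choose_div_le[OF d0] by (rule order_trans)
  have limit: "(\<lambda>n. F (n div d i) / real (n choose k)) \<longlonglongrightarrow> x * (1 / real (d i) ^ k)" for i
  proof -
    have div: "filterlim (\<lambda>n. n div d i) at_top at_top"
      unfolding filterlim_at_top
    proof
      fix Z
      show "\<forall>\<^sub>F n in sequentially. Z \<le> n div d i"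
        by (intro eventually_sequentiallyI[of "Z * d i"])
          (simp add: less_eq_div_iff_mult_less_eq d0)
    qed
    have "(\<lambda>n. F (n div d i) / real (n div d i choose k) * (real (n div d i choose k) / real (n choose k)))
        \<longlonglongrightarrow> x * (1 / real (d i) ^ k)"
      by (intro tendsto_mult filterlim_compose[OF lim div] tendsto_choose_div d0)
    \<comment> \<open>Where the inserted denominator vanishes, so does \<open>F\<close> by its
      bound; the cancellation therefore survives division by zero.\<close>
    moreover have "F (n div d i) = 0" if "n div d i choose k = 0" for n
      using bound[of "n div d i"] that by simp
    then have "F (n div d i) / real (n div d i choose k) * (real (n div d i choose k) / real (n choose k))
        = F (n div d i) / real (n choose k)" for n
      by (cases "n div d i choose k = 0") auto
    ultimately show ?thesis
      by (simp only:)
  qed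
  have "norm (F (n div d i) / real (n choose k)) \<le> 1 / real (d i) ^ k" for n i
  proof (cases "n choose k = 0")
    case False
    with F[of n i] show ?thesis
      by (simp add: field_simps abs_mult)
  qed (simp del: binomial_eq_0_iff)
  then have "(\<lambda>n. \<Sum>i. F (n div d i) / real (n choose k)) \<longlonglongrightarrow> (\<Sum>i. x * (1 / real (d i) ^ k))"
    by (intro tannerys_theorem[OF limit _ summ, THEN conjunct2, THEN conjunct2] always_eventually)
      auto
  moreover have "F (n div d i) = 0" if "n \<le> i" for n i
  proof -
    have "n div d i = 0"
      using d[of i] that by simp
    then show ?thesis
      using bound[of 0] k by (simp add: binomial_eq_0)
  qed
  then have "(\<Sum>i. F (n div d i) / real (n choose k)) = (\<Sum>i<n. F (n div d i)) / real (n choose k)" for n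
    by (subst suminf_finite[of "{..<n}"]) (auto simp: sum_divide_distrib)
  ultimately show ?thesis
    by (simp only: suminf_mult[OF summ])
qed

text \<open>
  Instead of inverting with the Moebius function, the error \<open>f\<close> is solved for from the \<open>i = 0\<close> term
  of its divisor sum; this is a contraction with factor \<open>zeta k - 1 < 1\<close>.
\<close>

lemma tendsto_choose_inversion:
  fixes P :: "nat \<Rightarrow> real"
  assumes k: "2 \<le> k"
    and P: "\<And>n. 0 \<le> P n" "\<And>n. P n \<le> real (n choose k)"
    and sum_P: "\<And>n. (\<Sum>i<n. P (n div Suc i)) = real (n choose k)"
  shows "(\<lambda>n. P n / real (n choose k)) \<longlonglongrightarrow> inverse (zeta k)"
proof -
  define C where "C n = real (n choose k)" for n
  define f where "f n = P n - inverse (zeta k) * C n" for n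
  define q where "q = zeta k - 1"
  have zeta: "1 \<le> zeta k" "zeta k < 2"
    using zeta_ge_1 zeta_less_2 k by auto
  have q: "0 \<le> q" "q < 1"
    using zeta by (auto simp: q_def)
  have C0: "0 \<le> C n" for n
    by (simp add: C_def)
  have f_bound: "\<bar>f n\<bar> \<le> C n" for n
  proof -
    have "inverse (zeta k) * C n \<le> C n" "0 \<le> inverse (zeta k) * C n"
      using zeta C0[of n] by (auto simp: field_simps mult_le_cancel_left1)
    then show ?thesis
      using P[of n] unfolding f_def C_def by linarith
  qed
  have ev_C: "\<forall>\<^sub>F n in sequentially. 0 < C n"
    by (intro eventually_sequentiallyI[of k]) (simp add: C_def)
  \<comment> \<open>The divisor sum of the error. It is negligible against \<open>C\<close>: the sum
    for \<open>P\<close> is exactly \<open>C\<close>, and the one for \<open>C\<close> is asymptotic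
    to \<open>zeta k * C\<close>, so the main terms cancel.\<close>
  define R where "R n = (\<Sum>i<n. f (n div Suc i))" for n
  have R: "(\<lambda>n. R n / C n) \<longlonglongrightarrow> 0"
  proof -
    have "(\<lambda>n. C n / C n) \<longlonglongrightarrow> 1"
      using ev_C by (intro tendsto_eventually) (auto elim: eventually_mono)
    then have "(\<lambda>n. (\<Sum>i<n. C (n div Suc i)) / C n) \<longlonglongrightarrow> 1 * zeta k"
      unfolding C_def zeta_def by (intro tendsto_sum_choose_div k) auto
    then have "(\<lambda>n. 1 - inverse (zeta k) * ((\<Sum>i<n. C (n div Suc i)) / C n))
        \<longlonglongrightarrow> 1 - inverse (zeta k) * (1 * zeta k)"
      by (intro tendsto_intros)
    moreover have "\<forall>\<^sub>F n in sequentially.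
        1 - inverse (zeta k) * ((\<Sum>i<n. C (n div Suc i)) / C n) = R n / C n"
      using ev_C
    proof eventually_elim
      case (elim n)
      have "R n = C n - inverse (zeta k) * (\<Sum>i<n. C (n div Suc i))"
        using sum_P[of n] by (simp add: R_def f_def C_def sum_subtractf sum_distrib_left)
      with elim show ?case
        by (simp add: diff_divide_distrib)
    qed
    ultimately show ?thesis
      using zeta by (simp add: tendsto_cong)
  qed
  have contract: "\<forall>\<^sub>F n in sequentially. \<bar>f n\<bar> \<le> (q * e + h) * C n"
    if e: "0 \<le> e" "\<forall>\<^sub>F n in sequentially. \<bar>f n\<bar> \<le> e * C n" and h: "0 < h" for e h
  proof -
    \<comment> \<open>The excess over the assumed bound. It vanishes for large arguments, but
      \<open>n div Suc i\<close> also takes small values; the total excess is still negligible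
      against \<open>C\<close>.\<close>
    define F where "F n = max 0 (\<bar>f n\<bar> - e * C n)" for n
    have F_bound: "\<bar>F n\<bar> \<le> real (n choose k)" for n
      using f_bound[of n] e(1) C0[of n] mult_nonneg_nonneg[OF e(1) C0[of n]]
      unfolding F_def C_def by linarith
    have "\<forall>\<^sub>F n in sequentially. F n / real (n choose k) = 0"
      using e(2) by eventually_elim (simp add: F_def)
    then have "(\<lambda>n. F n / real (n choose k)) \<longlonglongrightarrow> 0"
      by (rule tendsto_eventually)
    then have "(\<lambda>n. (\<Sum>i<n. F (n div Suc i)) / real (n choose k)) \<longlonglongrightarrow> 0 * (\<Sum>i. 1 / real (Suc i) ^ k)"
      by (intro tendsto_sum_choose_div k F_bound) auto
    then have "(\<lambda>n. (\<Sum>i<n. F (n div Suc i)) / C n + \<bar>R n / C n\<bar>) \<longlonglongrightarrow> 0"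
      using tendsto_add[OF _ tendsto_rabs_zero[OF R]] by (fastforce simp: C_def)
    then have "\<forall>\<^sub>F n in sequentially. (\<Sum>i<n. F (n div Suc i)) / C n + \<bar>R n / C n\<bar> < h"
      using h by (rule order_tendstoD)
    then show ?thesis
      using ev_C eventually_gt_at_top[of 0]
    proof eventually_elim
      case (elim n)
      then obtain m where n: "n = Suc m"
        by (cases n) auto
      have "R n = f n + (\<Sum>i<m. f (n div Suc (Suc i)))"
        by (simp add: R_def n sum.lessThan_Suc_shift del: sum.lessThan_Suc)
      then have "\<bar>f n\<bar> \<le> \<bar>R n\<bar> + \<bar>\<Sum>i<m. f (n div Suc (Suc i))\<bar>"
        by linarith
      also have "\<bar>\<Sum>i<m. f (n div Suc (Suc i))\<bar> \<le> (\<Sum>i<m. \<bar>f (n div Suc (Suc i))\<bar>)"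
        by (rule sum_abs)
      also have "\<dots> \<le> (\<Sum>i<m. F (n div Suc (Suc i)) + e * C n * (1 / real (Suc (Suc i)) ^ k))"
      proof (rule sum_mono)
        fix i
        have "e * C (n div Suc (Suc i)) \<le> e * (C n / real (Suc (Suc i)) ^ k)"
          unfolding C_def by (intro mult_left_mono choose_div_le e) simp
        then show "\<bar>f (n div Suc (Suc i))\<bar> \<le> F (n div Suc (Suc i)) + e * C n * (1 / real (Suc (Suc i)) ^ k)"
          unfolding F_def by simp
      qed
      also have "\<dots> = (\<Sum>i<m. F (n div Suc (Suc i))) + e * C n * (\<Sum>i<m. 1 / real (Suc (Suc i)) ^ k)"
        by (simp add: sum.distrib sum_distrib_left)
      also have "\<dots> \<le> (\<Sum>i<n. F (n div Suc i)) + e * C n * q"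
      proof (intro add_mono mult_left_mono)
        show "(\<Sum>i<m. F (n div Suc (Suc i))) \<le> (\<Sum>i<n. F (n div Suc i))"
          unfolding n sum.lessThan_Suc_shift by (simp add: F_def)
        show "(\<Sum>i<m. 1 / real (Suc (Suc i)) ^ k) \<le> q"
          using zeta_minus_1[OF k] unfolding q_def
          by (subst sums_unique, assumption) (intro sum_le_suminf, auto simp: sums_iff)
        show "0 \<le> e * C n"
          using e C0 by simp
      qed
      also have "\<bar>R n\<bar> + ((\<Sum>i<n. F (n div Suc i)) + e * C n * q)
          = ((\<Sum>i<n. F (n div Suc i)) / C n + \<bar>R n / C n\<bar> + q * e) * C n"
        using elim by (simp add: field_simps)
      also have "\<dots> \<le> (h + q * e) * C n"
        using elim by (intro mult_right_mono) auto
      finally show ?case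
        by (simp add: add.commute)
    qed
  qed
  \<comment> \<open>Any number strictly between \<open>q\<close> and 1 would do: the slack
    \<open>h = (r - q) * r ^ j\<close> turns \<open>q * r ^ j + h\<close> into
    \<open>r ^ Suc j\<close>.\<close>
  define r where "r = (1 + q) / 2"
  have r: "0 < r" "r < 1" "q < r"
    using q by (auto simp: r_def)
  have iter: "\<forall>\<^sub>F n in sequentially. \<bar>f n\<bar> \<le> r ^ j * C n" for j
  proof (induction j)
    case 0
    then show ?case
      using f_bound by simp
  next
    case (Suc j)
    have "\<forall>\<^sub>F n in sequentially. \<bar>f n\<bar> \<le> (q * r ^ j + (r - q) * r ^ j) * C n"
      using r Suc.IH by (intro contract) auto
    then show ?case
      by (simp add: algebra_simps)
  qed
  have "(\<lambda>n. f n / C n) \<longlonglongrightarrow> 0"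
  proof (rule tendstoI)
    fix e :: real assume "0 < e"
    then obtain j where j: "r ^ j < e"
      using real_arch_pow_inv r by blast
    show "\<forall>\<^sub>F n in sequentially. dist (f n / C n) 0 < e"
      using iter[of j] ev_C
    proof eventually_elim
      case (elim n)
      then have "\<bar>f n\<bar> / C n \<le> r ^ j"
        by (simp add: field_simps)
      with j elim show ?case
        by (simp add: abs_mult)
    qed
  qed
  then have "(\<lambda>n. f n / C n + inverse (zeta k)) \<longlonglongrightarrow> 0 + inverse (zeta k)"
    by (intro tendsto_intros)
  moreover have "\<forall>\<^sub>F n in sequentially. f n / C n + inverse (zeta k) = P n / real (n choose k)"
    using ev_C by eventually_elim (simp add: f_def C_def diff_divide_distrib)
  ultimately show ?thesis
    by (simp add: tendsto_cong)
qed

subsection \<open>Codes on rays\<close>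

definition entries_gcd :: "nat list \<Rightarrow> nat" where
  "entries_gcd t = Gcd (set t)"

text \<open>The primitive vector on the ray through a signal, so that proportionality becomes
  equality of directions.\<close>

definition direction :: "nat list \<Rightarrow> nat list" where
  "direction t = map (\<lambda>x. x div entries_gcd t) t"

definition primitive_signals :: "nat \<Rightarrow> nat \<Rightarrow> nat list set" where
  "primitive_signals N k = {t \<in> signals N k. entries_gcd t = 1}"

section \<open>Finiteness and number of signals\<close>

lemma signals_pos: "t \<in> signals N k \<Longrightarrow> x \<in> set t \<Longrightarrow> 0 < x"
  by (auto simp: signals_def)

lemma signals_nonempty: "t \<in> signals N k \<Longrightarrow> 0 < k \<Longrightarrow> t \<noteq> []"
  by (auto simp: signals_def)

lemma signals_Suc:
  "signals N (Suc k) = (\<Union>x\<in>{1..N}. (#) x ` signals (N - x) k)"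
proof (intro set_eqI iffI)
  fix t assume "t \<in> signals N (Suc k)"
  then obtain x u where "t = x # u" "length u = k" "1 \<le> x" "\<forall>y\<in>set u. 1 \<le> y" "x + sum_list u \<le> N"
    by (cases t) (auto simp: signals_def)
  then show "t \<in> (\<Union>x\<in>{1..N}. (#) x ` signals (N - x) k)"
    by (intro UN_I[of x] image_eqI[of _ _ u]) (auto simp: signals_def)
qed (auto simp: signals_def)

lemma finite_signals [simp]: "finite (signals N k)"
proof (induction k arbitrary: N)
  case 0
  have "signals N 0 = {[]}"
    by (auto simp: signals_def)
  then show ?case
    by simp
qed (simp add: signals_Suc)

lemma finite_primitive_signals [simp]: "finite (primitive_signals N k)"
  by (simp add: primitive_signals_def)

text \<open>Splitting off the first entry gives a recursion in \<open>k\<close>, solved by the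
  hockey-stick identity.\<close>

lemma card_signals: "card (signals N k) = N choose k"
proof (induction k arbitrary: N)
  case 0
  have "signals N 0 = {[]}"
    by (auto simp: signals_def)
  then show ?case
    by simp
next
  case (Suc k)
  have "card (signals N (Suc k)) = (\<Sum>x\<in>{1..N}. card ((#) x ` signals (N - x) k))"
    unfolding signals_Suc by (rule card_UN_disjoint) auto
  also have "\<dots> = (\<Sum>x\<in>{1..N}. (N - x) choose k)"
    by (simp add: card_image Suc.IH)
  also have "\<dots> = (\<Sum>i<N. i choose k)"
    by (rule sum.reindex_bij_witness[of _ "\<lambda>i. N - i" "\<lambda>x. N - x"]) auto
  also have "\<dots> = N choose Suc k"
    by (induction N) auto
  finally show ?case .
qed

lemma card_primitive_signals_le: "card (primitive_signals N k) \<le> N choose k"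
  unfolding card_signals[symmetric] by (rule card_mono) (auto simp: primitive_signals_def)

section \<open>Multipliers and directions\<close>

lemma entries_gcd_pos:
  assumes "t \<in> signals N k" "0 < k"
  shows "0 < entries_gcd t"
proof -
  obtain x where "x \<in> set t"
    using signals_nonempty[OF assms] by (cases t) auto
  moreover from this have "0 < x"
    using signals_pos assms by blast
  ultimately show ?thesis
    by (metis Gcd_dvd entries_gcd_def dvd_pos_nat)
qed

lemma entries_gcd_dvd: "x \<in> set t \<Longrightarrow> entries_gcd t dvd x"
  by (simp add: entries_gcd_def)

lemma entries_gcd_scale [simp]: "entries_gcd (map ((*) c) t) = c * entries_gcd t"
  by (simp add: entries_gcd_def Gcd_mult)

lemma sum_list_scale: "sum_list (map ((*) c) t) = c * sum_list t" for c :: nat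
  by (induction t) (simp_all add: algebra_simps)

lemma scale_direction: "map ((*) (entries_gcd t)) (direction t) = t"
  by (simp add: direction_def map_idI entries_gcd_dvd)

lemma direction_scale:
  assumes "0 < c" "entries_gcd t = 1"
  shows "direction (map ((*) c) t) = t"
  using assms by (simp add: direction_def map_idI)

lemma scale_mem_signals:
  assumes "p \<in> signals (N div c) k" "0 < c"
  shows "map ((*) c) p \<in> signals N k"
proof -
  have "sum_list (map ((*) c) p) = c * sum_list p"
    by (rule sum_list_scale)
  also have "\<dots> \<le> c * (N div c)"
    using assms by (simp add: signals_def)
  also have "\<dots> \<le> N"
    by simp
  finally show ?thesis
    using assms by (auto simp: signals_def Suc_le_eq)
qed

text \<open>A multiplier of at least \<open>c\<close> forces
  \<open>c * sum_list (direction t) \<le> sum_list t \<le> N\<close>. Taking \<open>c = 1\<close>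
  shows just that the direction is a primitive signal within the bound \<open>N\<close>.\<close>

lemma direction_mem_primitive_signals:
  assumes "t \<in> signals N k" "0 < k" "0 < c" "c \<le> entries_gcd t"
  shows "direction t \<in> primitive_signals (N div c) k"
proof -
  have t: "map ((*) (entries_gcd t)) (direction t) = t"
    by (rule scale_direction)
  have pos: "0 < entries_gcd t"
    using entries_gcd_pos assms by blast
  have "entries_gcd t * entries_gcd (direction t) = entries_gcd t"
    by (metis t entries_gcd_scale)
  then have "entries_gcd (direction t) = 1"
    using pos by simp
  moreover have "sum_list (direction t) \<le> N div c"
  proof -
    have "c * sum_list (direction t) \<le> entries_gcd t * sum_list (direction t)"
      using assms by simp
    also have "\<dots> = sum_list t"
      by (metis t sum_list_scale)
    also have "\<dots> \<le> N"
      using assms by (simp add: signals_def)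
    finally show ?thesis
      using assms by (simp add: less_eq_div_iff_mult_less_eq mult.commute)
  qed
  moreover have "1 \<le> x" if "x \<in> set (direction t)" for x
  proof -
    have "entries_gcd t * x \<in> set (map ((*) (entries_gcd t)) (direction t))"
      unfolding set_map using that by (rule imageI)
    then have "0 < entries_gcd t * x"
      unfolding t using assms signals_pos by blast
    then show ?thesis
      by simp
  qed
  moreover have "length (direction t) = k"
    using assms by (simp add: direction_def signals_def)
  ultimately show ?thesis
    by (simp add: primitive_signals_def signals_def)
qed

text \<open>For fixed \<open>i\<close>, the cross products say that \<open>s ! i\<close> times
  \<open>t\<close> equals \<open>t ! i\<close> times \<open>s\<close>. Taking gcds of both sides and
  cancelling yields equal entries at \<open>i\<close>.\<close>

lemma direction_eqI:
  assumes "length s = length t"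
    and cross: "\<And>i j. i < length t \<Longrightarrow> j < length t \<Longrightarrow> s ! i * t ! j = t ! i * s ! j"
    and "0 < entries_gcd s" "0 < entries_gcd t"
  shows "direction s = direction t"
proof (rule nth_equalityI)
  show "length (direction s) = length (direction t)"
    using assms by (simp add: direction_def)
next
  fix i assume "i < length (direction s)"
  then have i: "i < length s" "i < length t"
    using assms by (auto simp: direction_def)
  have "map ((*) (s ! i)) t = map ((*) (t ! i)) s"
    using assms i by (intro nth_equalityI) auto
  then have eq: "s ! i * entries_gcd t = t ! i * entries_gcd s"
    by (metis entries_gcd_scale)
  obtain x y where "s ! i = entries_gcd s * x" "t ! i = entries_gcd t * y"
    using i by (meson entries_gcd_dvd dvdE nth_mem)
  with eq assms show "direction s ! i = direction t ! i"
    using i by (auto simp: direction_def)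
qed

section \<open>Confusability across rays and along a ray\<close>

lemma confusable_commute: "confusable abar s t \<longleftrightarrow> confusable abar t s"
  by (simp add: confusable_def Int_commute)

text \<open>Even a single common output \<open>a * s = b * t\<close> makes the signals
  proportional.\<close>

lemma not_confusable_if_direction_neq:
  assumes s: "s \<in> signals N k" and t: "t \<in> signals N k" and k: "0 < k"
    and neq: "direction s \<noteq> direction t"
  shows "\<not> confusable abar s t"
proof
  assume "confusable abar s t"
  then have "outputs abar s \<inter> outputs abar t \<noteq> {}"
    unfolding confusable_def by (metis finite.emptyI)
  then obtain a b where ab: "1 \<le> a" "1 \<le> b" and eq: "map (\<lambda>x. a * real x) s = map (\<lambda>x. b * real x) t"
    by (auto simp: outputs_def stretch_factors_def)
  have len: "length s = length t"
    using s t by (simp add: signals_def)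
  have nth: "a * real (s ! i) = b * real (t ! i)" if "i < length t" for i
    using arg_cong[OF eq, of "\<lambda>u. u ! i"] that len by simp
  have "s ! i * t ! j = t ! i * s ! j" if "i < length t" "j < length t" for i j
  proof -
    have "a * b * (real (s ! i) * real (t ! j)) = (a * real (s ! i)) * (b * real (t ! j))"
      by simp
    also have "\<dots> = (b * real (t ! i)) * (a * real (s ! j))"
      using nth that by simp
    also have "\<dots> = a * b * (real (t ! i) * real (s ! j))"
      by simp
    finally have "real (s ! i * t ! j) = real (t ! i * s ! j)"
      using ab by simp
    then show ?thesis
      by (simp only: of_nat_eq_iff)
  qed
  then show False
    using neq direction_eqI[OF len] entries_gcd_pos[OF s k] entries_gcd_pos[OF t k] by blast
qed

text \<open>Outputs of multiples of \<open>p\<close> are parametrised by the total factor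
  \<open>z\<close> in front of \<open>p\<close>, so that comparing them becomes comparing intervals
  of \<open>z\<close>.\<close>

lemma scaled_outputs:
  assumes "z / real c \<in> stretch_factors abar" "0 < c"
  shows "map (\<lambda>x. z * real x) p \<in> outputs abar (map ((*) c) p)"
  unfolding outputs_def using assms by (auto intro!: exI[of _ "z / real c"])

text \<open>The factors for \<open>g\<close> fill the interval from \<open>g\<close> to
  \<open>abar * g\<close>, those for \<open>h\<close> start at \<open>h\<close>; the overlap is a
  nondegenerate interval. The bound is an \<open>ereal\<close> so that finite and infinite
  \<open>abar\<close> are covered at once.\<close>

lemma confusable_scale:
  assumes "p \<noteq> []" "\<And>x. x \<in> set p \<Longrightarrow> 0 < x" "0 < g" "g < h"
    and less: "ereal (real h) < abar * ereal (real g)"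
  shows "confusable abar (map ((*) g) p) (map ((*) h) p)"
proof -
  \<comment> \<open>A right end for an interval of common factors: \<open>abar * g\<close> if
    \<open>abar\<close> is finite, otherwise any number above \<open>h\<close>.\<close>
  obtain y where y: "real h < y" "ereal (y / real g) \<le> abar"
  proof (cases abar)
    case (real r)
    with less assms show ?thesis
      by (intro that[of "r * real g"]) auto
  next
    case PInf
    then show ?thesis
      by (intro that[of "real h + 1"]) auto
  next
    case MInf
    with less assms show ?thesis
      by simp
  qed
  have factor: "z / real c \<in> stretch_factors abar" if "real h \<le> z" "z \<le> y" "g \<le> c" "c \<le> h" for z c
  proof -
    have "0 < real c" "real c \<le> z"
      using that assms by auto
    then have "1 \<le> z / real c"
      by simp
    moreover have "z / real c \<le> y / real g"
      using that assms by (intro frac_le) auto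
    then have "ereal (z / real c) \<le> abar"
      using y by (meson ereal_less_eq(3) order_trans)
    ultimately show ?thesis
      by (simp add: stretch_factors_def)
  qed
  have "(\<lambda>z. map (\<lambda>x. z * real x) p) ` {real h..y}
      \<subseteq> outputs abar (map ((*) g) p) \<inter> outputs abar (map ((*) h) p)"
    using assms by (auto intro!: scaled_outputs factor)
  moreover have "inj (\<lambda>z::real. map (\<lambda>x. z * real x) p)"
  proof (rule injI)
    fix z w :: real
    assume "map (\<lambda>x. z * real x) p = map (\<lambda>x. w * real x) p"
    then have "z * real (hd p) = w * real (hd p)"
      using assms(1) by (cases p) auto
    then show "z = w"
      using assms(1,2) by (simp add: neq_Nil_conv) fastforce
  qed
  then have "infinite ((\<lambda>z. map (\<lambda>x. z * real x) p) ` {real h..y})"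
    using y by (subst finite_image_iff) (auto intro: inj_on_subset)
  ultimately show ?thesis
    unfolding confusable_def using finite_subset by blast
qed

lemma scaled_outputsE:
  assumes "u \<in> outputs (ereal a) (map ((*) c) p)"
  obtains z where "u = map (\<lambda>x. z * real x) p" "real c \<le> z" "z \<le> a * real c"
proof -
  obtain b where b: "u = map (\<lambda>x. b * real x) (map ((*) c) p)" "1 \<le> b" "b \<le> a"
    using assms by (auto simp: outputs_def stretch_factors_def)
  have "1 * real c \<le> b * real c"
    by (intro mult_right_mono) (use b in auto)
  moreover have "b * real c \<le> a * real c"
    by (intro mult_right_mono) (use b in auto)
  ultimately show ?thesis
    using b(1) by (intro that[of "b * real c"]) (simp_all add: mult.assoc)
qed

text \<open>The intervals of factors meet at most in the point \<open>h\<close>, and one common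
  output does not make signals confusable.\<close>

lemma not_confusable_scale:
  assumes p: "p \<noteq> []" "\<And>x. x \<in> set p \<Longrightarrow> 0 < x" and le: "a * real g \<le> real h"
  shows "\<not> confusable (ereal a) (map ((*) g) p) (map ((*) h) p)"
proof -
  have "outputs (ereal a) (map ((*) g) p) \<inter> outputs (ereal a) (map ((*) h) p)
      \<subseteq> {map (\<lambda>x. real h * real x) p}"
  proof
    fix u assume u: "u \<in> outputs (ereal a) (map ((*) g) p) \<inter> outputs (ereal a) (map ((*) h) p)"
    obtain z where z: "u = map (\<lambda>x. z * real x) p" "z \<le> a * real g"
      using u by (auto elim: scaled_outputsE)
    obtain w where w: "u = map (\<lambda>x. w * real x) p" "real h \<le> w"
      using u by (auto elim: scaled_outputsE)
    have "z * real (hd p) = w * real (hd p)"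
      using z(1) w(1) p(1) by (metis hd_map)
    moreover have "0 < real (hd p)"
      using p by simp
    ultimately have "z = w"
      by simp
    then have "z = real h"
      using z(2) w(2) le by linarith
    then show "u \<in> {map (\<lambda>x. real h * real x) p}"
      using z(1) by simp
  qed
  then show ?thesis
    unfolding confusable_def using finite_subset by blast
qed

section \<open>Optimal codes\<close>

text \<open>Greedy stays ahead: by induction along \<open>G\<close>, the step from the predecessor
  \<open>m\<close> of \<open>g\<close> is one the sequence \<open>d\<close> can follow. The
  hypotheses on \<open>d\<close> are abstract so that they hold for \<open>Suc\<close> with
  \<open>a = 1\<close> as well as for the ceiling recursion.\<close>

lemma separated_rank_le:
  fixes d :: "nat \<Rightarrow> nat" and a :: real
  assumes d: "d 0 = 1" "\<And>n g h. d n \<le> g \<Longrightarrow> g < h \<Longrightarrow> a * real g \<le> real h \<Longrightarrow> d (Suc n) \<le> h"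
    and G: "finite G" "\<And>g. g \<in> G \<Longrightarrow> 0 < g"
      "\<And>g h. g \<in> G \<Longrightarrow> h \<in> G \<Longrightarrow> g < h \<Longrightarrow> a * real g \<le> real h"
    and "g \<in> G"
  shows "d (card {h \<in> G. h < g}) \<le> g"
  using \<open>g \<in> G\<close>
proof (induction g rule: less_induct)
  case (less g)
  show ?case
  proof (cases "{h \<in> G. h < g} = {}")
    case True
    then show ?thesis
      using G(2)[OF less.prems] d(1) by (simp only: card.empty)
  next
    case False
    define m where "m = Max {h \<in> G. h < g}"
    have "m \<in> {h \<in> G. h < g}"
      unfolding m_def using G(1) False by (intro Max_in) auto
    then have m: "m \<in> G" "m < g"
      by auto
    have "h \<le> m" if "h \<in> G" "h < g" for h
      unfolding m_def using G(1) that by (intro Max_ge) auto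
    then have "{h \<in> G. h < g} = insert m {h \<in> G. h < m}"
      using m by force
    then have "card {h \<in> G. h < g} = Suc (card {h \<in> G. h < m})"
      using G(1) by simp
    then show ?thesis
      using d(2)[OF less.IH[OF m(2,1)] m(2)] G(3) m less.prems by simp
  qed
qed

text \<open>A signal is determined by its direction and its rank among the code's multipliers on
  that ray. At rank \<open>n\<close> the multiplier is at least \<open>d n\<close>, so the direction
  has sum at most \<open>N div d n\<close>.\<close>

lemma card_zero_error_code_le:
  fixes d :: "nat \<Rightarrow> nat" and a :: real
  assumes code: "zero_error_code (ereal a) N k S" and k: "0 < k"
    and d: "d 0 = 1" "\<And>n g h. d n \<le> g \<Longrightarrow> g < h \<Longrightarrow> a * real g \<le> real h \<Longrightarrow> d (Suc n) \<le> h"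
      "\<And>n. n < d n"
  shows "card S \<le> (\<Sum>n<N. card (primitive_signals (N div d n) k))"
proof -
  have S: "S \<subseteq> signals N k"
    using code by (simp add: zero_error_code_def)
  then have fin: "finite S"
    using finite_subset finite_signals by blast
  define G where "G p = entries_gcd ` {s \<in> S. direction s = p}" for p
  define rank where "rank t = card {h \<in> G (direction t). h < entries_gcd t}" for t
  have finG: "finite (G p)" for p
    using fin by (simp add: G_def)
  have posG: "0 < g" if "g \<in> G p" for g p
    using that S entries_gcd_pos k by (auto simp: G_def)
  have sepG: "a * real g \<le> real h" if gh: "g \<in> G p" "h \<in> G p" "g < h" for g h p
  proof (rule ccontr)
    assume not_le: "\<not> a * real g \<le> real h"
    obtain s t where s: "s \<in> S" "direction s = p" "entries_gcd s = g"
      and t: "t \<in> S" "direction t = p" "entries_gcd t = h"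
      using gh by (auto simp: G_def)
    have st: "s = map ((*) g) p" "t = map ((*) h) p"
      using s t scale_direction by metis+
    have "p \<in> signals N k"
      using direction_mem_primitive_signals[of s N k 1] s S k entries_gcd_pos[of s N k]
      by (auto simp: primitive_signals_def Suc_le_eq)
    then have "confusable (ereal a) s t"
      unfolding st using not_le gh posG signals_nonempty k signals_pos
      by (intro confusable_scale) auto
    moreover have "s \<noteq> t"
      using s t gh by auto
    ultimately show False
      using code s t by (auto simp: zero_error_code_def)
  qed
  have memG: "entries_gcd t \<in> G (direction t)" if "t \<in> S" for t
    using that by (auto simp: G_def)
  have rank_le: "d (rank t) \<le> entries_gcd t" if "t \<in> S" for t
    unfolding rank_def using memG[OF that] finG posG sepG
    by (intro separated_rank_le[where a = a and d = d] d) auto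
  define X where "X = Sigma {..<N} (\<lambda>n. primitive_signals (N div d n) k)"
  have "inj_on (\<lambda>t. (rank t, direction t)) S"
  proof (rule inj_onI)
    fix s t assume s: "s \<in> S" and t: "t \<in> S" and "(rank s, direction s) = (rank t, direction t)"
    then have dir: "direction s = direction t" and rank: "rank s = rank t"
      by auto
    \<comment> \<open>On a common ray the rank strictly increases with the multiplier, hence it
      recovers the multiplier.\<close>
    have strict: "rank u < rank v"
      if "u \<in> S" "direction u = direction v" "entries_gcd u < entries_gcd v" for u v
      unfolding rank_def using that memG[OF that(1)] finG
      by (intro psubset_card_mono) auto
    have "entries_gcd s = entries_gcd t"
      using strict[of s t] strict[of t s] s t dir rank by (metis less_irrefl nat_neq_iff)
    then show "s = t"
      using scale_direction dir by metis
  qed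
  moreover have "(\<lambda>t. (rank t, direction t)) ` S \<subseteq> X"
  proof clarify
    fix t assume t: "t \<in> S"
    have dpos: "0 < d (rank t)"
      using d(3)[of "rank t"] by simp
    have mem: "direction t \<in> primitive_signals (N div d (rank t)) k"
      using t S rank_le k dpos by (intro direction_mem_primitive_signals) auto
    \<comment> \<open>No signal of positive length has sum 0. Hence
      \<open>rank t < d (rank t) \<le> N\<close>, which justifies cutting the index off at
      \<open>N\<close>.\<close>
    have "N div d (rank t) \<noteq> 0"
    proof
      assume "N div d (rank t) = 0"
      then have "direction t \<in> signals 0 k"
        using mem by (simp add: primitive_signals_def)
      then show False
        using k by (cases "direction t") (auto simp: signals_def)
    qed
    then have "d (rank t) \<le> N"
      by (simp add: div_eq_0_iff dpos not_less)
    with d(3)[of "rank t"] mem show "(rank t, direction t) \<in> X"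
      by (simp add: X_def)
  qed
  ultimately have "card S \<le> card X"
    by (intro card_inj_on_le) (auto simp: X_def)
  then show ?thesis
    by (simp add: X_def)
qed

text \<open>The code consists of all \<open>d n\<close> multiples of primitive signals that fit into
  \<open>N\<close>. Distinct rays never interfere, and on one ray the multipliers are
  separated.\<close>

lemma exists_zero_error_code:
  fixes d :: "nat \<Rightarrow> nat" and a :: real
  assumes k: "0 < k"
    and d: "strict_mono d" "\<And>n. 0 < d n" "\<And>i j. i < j \<Longrightarrow> a * real (d i) \<le> real (d j)"
  shows "\<exists>S. zero_error_code (ereal a) N k S \<and>
    card S = (\<Sum>n<N. card (primitive_signals (N div d n) k))"
proof -
  define X where "X = Sigma {..<N} (\<lambda>n. primitive_signals (N div d n) k)"
  define f where "f = (\<lambda>(n, p). map ((*) (d n)) p)"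
  have X: "p \<in> signals (N div d n) k" "entries_gcd p = 1" if "(n, p) \<in> X" for n p
    using that by (auto simp: X_def primitive_signals_def)
  have f: "f (n, p) \<in> signals N k" "direction (f (n, p)) = p" "entries_gcd (f (n, p)) = d n"
    if "(n, p) \<in> X" for n p
    using X[OF that] d(2) by (auto simp: f_def scale_mem_signals direction_scale)
  have "inj_on f X"
  proof (rule inj_onI, clarify)
    fix n p m q assume *: "(n, p) \<in> X" "(m, q) \<in> X" "f (n, p) = f (m, q)"
    then have "p = q" "d n = d m"
      using f by metis+
    then show "n = m \<and> p = q"
      using d(1) by (simp add: strict_mono_eq)
  qed
  then have "card (f ` X) = (\<Sum>n<N. card (primitive_signals (N div d n) k))"
    by (simp add: card_image X_def)
  moreover have "zero_error_code (ereal a) N k (f ` X)"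
    unfolding zero_error_code_def
  proof (intro conjI)
    show "f ` X \<subseteq> signals N k"
      using f by auto
    have "\<not> confusable (ereal a) (f (n, p)) (f (m, q))"
      if nm: "(n, p) \<in> X" "(m, q) \<in> X" "(n, p) \<noteq> (m, q)" for n p m q
    proof (cases "p = q")
      case False
      then show ?thesis
        using not_confusable_if_direction_neq f nm k by metis
    next
      case True
      have p: "p \<noteq> []" "\<And>x. x \<in> set p \<Longrightarrow> 0 < x"
        using X nm signals_nonempty signals_pos k by blast+
      have ray: "\<not> confusable (ereal a) (f (i, p)) (f (j, p))" if "i < j" for i j
        unfolding f_def using not_confusable_scale[OF p d(3)[OF that]] by simp
      show ?thesis
        using ray[of n m] ray[of m n] nm True confusable_commute by (metis nat_neq_iff)
    qed
    then show "\<forall>s\<in>f ` X. \<forall>t\<in>f ` X. s \<noteq> t \<longrightarrow> \<not> confusable (ereal a) s t"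
      by (metis (no_types, lifting) imageE surj_pair)
  qed
  ultimately show ?thesis
    by blast
qed

lemma max_density_eqI:
  assumes "\<exists>S. zero_error_code abar N k S \<and> card S = m"
    and "\<And>S. zero_error_code abar N k S \<Longrightarrow> card S \<le> m"
  shows "max_density abar k N = real m / real (N choose k)"
proof -
  have "finite {S. zero_error_code abar N k S}"
    by (rule finite_subset[of _ "Pow (signals N k)"]) (auto simp: zero_error_code_def)
  then have "finite {real (card S) / real (N choose k) | S. zero_error_code abar N k S}"
    by simp
  then show ?thesis
    unfolding max_density_def using assms
    by (intro Max_eqI) (auto intro: divide_right_mono)
qed

text \<open>The case \<open>a = 1\<close> with \<open>d = Suc\<close>: every signal has a single
  output, so all signals together form a code and both bounds apply. This is the divisor-sum
  identity to be inverted.\<close>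

lemma choose_eq_sum_primitive:
  assumes "0 < k"
  shows "N choose k = (\<Sum>n<N. card (primitive_signals (N div Suc n) k))"
proof (rule antisym)
  have "\<not> confusable (ereal 1) s t" for s t
  proof -
    have "stretch_factors (ereal 1) = {1}"
      by (auto simp: stretch_factors_def)
    then have "outputs (ereal 1) s = {map real s}"
      by (simp add: outputs_def)
    then show ?thesis
      by (simp add: confusable_def)
  qed
  then have "zero_error_code (ereal 1) N k (signals N k)"
    by (simp add: zero_error_code_def)
  from card_zero_error_code_le[OF this assms, of Suc]
  show "N choose k \<le> (\<Sum>n<N. card (primitive_signals (N div Suc n) k))"
    by (simp add: card_signals)
  obtain S where "zero_error_code (ereal 1) N k S"
      "card S = (\<Sum>n<N. card (primitive_signals (N div Suc n) k))"
    using exists_zero_error_code[of k Suc 1 N] assms by (auto simp: strict_mono_Suc_iff)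
  then show "(\<Sum>n<N. card (primitive_signals (N div Suc n) k)) \<le> N choose k"
    by (metis card_mono card_signals finite_signals zero_error_code_def)
qed

text \<open>With unbounded stretching any two signals on a ray are confusable, so a code picks at
  most one per ray; the primitive signals pick one from every ray that meets
  \<open>signals N k\<close>.\<close>

lemma max_density_infinity:
  assumes k: "0 < k"
  shows "max_density \<infinity> k N = real (card (primitive_signals N k)) / real (N choose k)"
proof (rule max_density_eqI)
  have dir: "direction t = t" if "t \<in> primitive_signals N k" for t
    using that by (simp add: primitive_signals_def direction_def)
  have "zero_error_code \<infinity> N k (primitive_signals N k)"
    unfolding zero_error_code_def
  proof (intro conjI ballI impI)
    fix s t assume "s \<in> primitive_signals N k" "t \<in> primitive_signals N k" "s \<noteq> t"
    then show "\<not> confusable \<infinity> s t"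
      using dir k by (intro not_confusable_if_direction_neq[of _ N k]) (auto simp: primitive_signals_def)
  qed (auto simp: primitive_signals_def)
  then show "\<exists>S. zero_error_code \<infinity> N k S \<and> card S = card (primitive_signals N k)"
    by blast
  fix S assume code: "zero_error_code \<infinity> N k S"
  then have S: "S \<subseteq> signals N k"
    by (simp add: zero_error_code_def)
  have mem: "direction t \<in> primitive_signals N k" if "t \<in> S" for t
    using direction_mem_primitive_signals[of t N k 1] that S k entries_gcd_pos[of t N k] by auto
  have "inj_on direction S"
  proof (rule inj_onI)
    fix s t assume st: "s \<in> S" "t \<in> S" "direction s = direction t"
    have conf: "confusable \<infinity> u v"
      if "u \<in> S" "v \<in> S" "direction u = direction v" "entries_gcd u < entries_gcd v" for u v
    proof -
      have "direction u \<in> signals N k" "0 < entries_gcd u"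
        using mem that S entries_gcd_pos k by (auto simp: primitive_signals_def)
      then have "confusable \<infinity> (map ((*) (entries_gcd u)) (direction u)) (map ((*) (entries_gcd v)) (direction u))"
        using that signals_nonempty k signals_pos by (intro confusable_scale) auto
      then show ?thesis
        using that scale_direction by metis
    qed
    have "entries_gcd s = entries_gcd t" if "s \<noteq> t"
      using conf[of s t] conf[of t s] st that code
      unfolding zero_error_code_def by (metis nat_neq_iff)
    then show "s = t"
      using st scale_direction by metis
  qed
  then show "card S \<le> card (primitive_signals N k)"
    using mem by (intro card_inj_on_le) auto
qed

subsection \<open>Densities\<close>

lemma ceiling_seq_ge_1:
  assumes "1 \<le> a"
  shows "1 \<le> ceiling_seq a n"
proof (induction n)
  case (Suc n)
  have "1 * 1 \<le> a * real_of_int (ceiling_seq a n)"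
    using assms Suc by (intro mult_mono) auto
  then show ?case
    by simp
qed simp

lemma d_seq_pos:
  assumes "1 \<le> a"
  shows "0 < d_seq a n"
  using ceiling_seq_ge_1[OF assms, of n] by (auto simp: d_seq_def)

lemma d_seq_less_Suc:
  assumes "1 \<le> a"
  shows "d_seq a n < d_seq a (Suc n)"
proof (cases "a = 1")
  case False
  then have "1 * real_of_int (ceiling_seq a n) < a * real_of_int (ceiling_seq a n)"
    using ceiling_seq_ge_1[OF assms, of n] assms by (intro mult_strict_right_mono) auto
  also have "\<dots> \<le> real_of_int \<lceil>a * real_of_int (ceiling_seq a n)\<rceil>"
    by (rule le_of_int_ceiling)
  finally show ?thesis
    using False by (simp add: d_seq_def)
qed (simp add: d_seq_def)

lemma d_seq_separated:
  assumes "1 \<le> a" "i < j"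
  shows "a * real_of_int (d_seq a i) \<le> real_of_int (d_seq a j)"
proof -
  have "a * real_of_int (d_seq a i) \<le> real_of_int (d_seq a (Suc i))"
    by (cases "a = 1") (simp_all add: d_seq_def)
  moreover have "d_seq a (Suc i) \<le> d_seq a j"
    using assms(2) by (intro lift_Suc_mono_le[of "d_seq a", OF less_imp_le[OF d_seq_less_Suc]]
        assms(1)) simp
  ultimately show ?thesis
    by linarith
qed

text \<open>Greediness: the ceiling is the least integer that is at least
  \<open>a * d_seq a n\<close>. For \<open>a = 1\<close> the separation is only
  \<open>g < h\<close>, which matches steps of 1.\<close>

lemma d_seq_Suc_le:
  assumes "1 \<le> a" "d_seq a n \<le> g" "g < h" "a * real_of_int g \<le> real_of_int h"
  shows "d_seq a (Suc n) \<le> h"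
proof (cases "a = 1")
  case False
  have "a * real_of_int (d_seq a n) \<le> a * real_of_int g"
    using assms by (intro mult_left_mono) auto
  then have "a * real_of_int (d_seq a n) \<le> real_of_int h"
    using assms by linarith
  then show ?thesis
    using False by (simp add: d_seq_def ceiling_le_iff)
qed (use assms in \<open>simp add: d_seq_def\<close>)

section \<open>Limits of the densities\<close>

lemma tendsto_primitive_density:
  assumes "2 \<le> k"
  shows "(\<lambda>N. real (card (primitive_signals N k)) / real (N choose k)) \<longlonglongrightarrow> inverse (zeta k)"
proof (rule tendsto_choose_inversion[OF assms])
  show "real (card (primitive_signals N k)) \<le> real (N choose k)" for N
    using card_primitive_signals_le by simp
  show "(\<Sum>i<N. real (card (primitive_signals (N div Suc i) k))) = real (N choose k)" for N
    using choose_eq_sum_primitive[of k N] assms by simp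
qed simp

lemma max_density_infinity_tendsto:
  assumes "2 \<le> k"
  shows "max_density \<infinity> k \<longlonglongrightarrow> inverse (zeta k)"
proof -
  have "max_density \<infinity> k = (\<lambda>N. real (card (primitive_signals N k)) / real (N choose k))"
    using assms by (intro ext max_density_infinity) simp
  then show ?thesis
    using tendsto_primitive_density[OF assms] by simp
qed

lemma max_density_tendsto:
  assumes k: "2 \<le> k" and a: "1 \<le> a"
  shows "max_density (ereal a) k
    \<longlonglongrightarrow> inverse (zeta k) * (\<Sum>n. 1 / real_of_int (d_seq a n) ^ k)"
proof -
  \<comment> \<open>The sequence as natural numbers. Indices start at 0 with \<open>d 0 = 1\<close>,
    so strict growth gives \<open>n < d n\<close>.\<close>
  define d where "d n = nat (d_seq a n)" for n
  have int_d: "int (d n) = d_seq a n" for n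
    using d_seq_pos[OF a, of n] by (simp add: d_def)
  have real_d: "real (d n) = real_of_int (d_seq a n)" for n
    using int_d[of n] by (metis of_int_of_nat_eq)
  have d0: "d 0 = 1"
    by (simp add: d_def d_seq_def)
  have d_pos: "0 < d n" for n
    using int_d[of n] d_seq_pos[OF a, of n] by simp
  have mono: "strict_mono d"
    unfolding strict_mono_Suc_iff using int_d d_seq_less_Suc[OF a] by (metis of_nat_less_iff)
  have n_less: "n < d n" for n
  proof (induction n)
    case (Suc n)
    then show ?case
      using strict_monoD[OF mono, of n "Suc n"] by simp
  qed (simp add: d0)
  have next_le: "d (Suc n) \<le> h" if "d n \<le> g" "g < h" "a * real g \<le> real h" for n g h
    using d_seq_Suc_le[OF a, of n "int g" "int h"] that by (simp flip: int_d)
  \<comment> \<open>Construction and upper bound agree, so the maximum is known exactly for every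
    \<open>N\<close>; only the primitive counts are asymptotic.\<close>
  have "max_density (ereal a) k N
      = real (\<Sum>n<N. card (primitive_signals (N div d n) k)) / real (N choose k)" for N
  proof (rule max_density_eqI)
    show "\<exists>S. zero_error_code (ereal a) N k S \<and>
        card S = (\<Sum>n<N. card (primitive_signals (N div d n) k))"
      using k d_seq_separated[OF a] mono d_pos
      by (intro exists_zero_error_code) (auto simp: real_d)
    show "card S \<le> (\<Sum>n<N. card (primitive_signals (N div d n) k))"
      if "zero_error_code (ereal a) N k S" for S
      using that k d0 next_le n_less by (intro card_zero_error_code_le[where a = a]) auto
  qed
  then have eq: "max_density (ereal a) k
      = (\<lambda>N. (\<Sum>n<N. real (card (primitive_signals (N div d n) k))) / real (N choose k))"
    by auto
  have "(\<lambda>N. (\<Sum>n<N. real (card (primitive_signals (N div d n) k))) / real (N choose k))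
      \<longlonglongrightarrow> inverse (zeta k) * (\<Sum>n. 1 / real (d n) ^ k)"
    by (intro tendsto_sum_choose_div k n_less tendsto_primitive_density)
      (simp_all add: card_primitive_signals_le)
  then show ?thesis
    by (simp add: eq real_d)
qed

theorem theorem2:
  fixes k :: nat
  assumes "k \<ge> 2"
  shows "(\<forall>abar::ereal. 1 \<le> abar \<longrightarrow> convergent (max_density abar k)) \<and>
    (\<forall>a::real. 1 \<le> a \<longrightarrow>
       delta (ereal a) k = inverse (zeta k) * (\<Sum>n. 1 / real_of_int (d_seq a n) ^ k)) \<and>
    delta \<infinity> k = inverse (zeta k)"
proof (intro conjI allI impI)
  fix abar :: ereal
  assume "1 \<le> abar"
  then show "convergent (max_density abar k)"
    using max_density_infinity_tendsto max_density_tendsto assms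
    by (cases abar) (auto simp: convergent_def)
qed (use max_density_infinity_tendsto max_density_tendsto assms in
    \<open>auto simp: delta_def intro!: limI\<close>)

end
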